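(* If $(X,\lambda)$ is a convergence approach space, then $\lambda_{uF}$ is a non-Archimedean approach structure on $\mathcal{C}_X$ satisfying $\lambda_{uK}\geq\lambda_{uF}$ (pointwise, i.e. $\lambda_{uK}\mathfrak{F}(A)\geq\lambda_{uF}\mathfrak{F}(A)$ for every filter $\mathfrak{F}$ on $\mathcal{C}_X$ and every $A\in\mathcal{C}_X$). Here $\mathcal{C}_X$ stands for either $\mathcal{C}_{c(\lambda)}$ or $\mathcal{C}_{r(\lambda)}$.
   Context: $\mathbb{F}X$ is the set of (proper) filters on $X$, $\mathbb{P}X$ the powerset; $\mathcal{F}\leq\mathcal{G}$ means $\mathcal{F}\subset\mathcal{G}$. For $\mathcal{A}\subset\mathbb{P}X$, $\mathcal{A}^{\#}=\{B\subset X:\forall A\in\mathcal{A},\ A\cap B\neq\emptyset\}$; $\mathcal{A}\#\mathcal{B}$ means $\mathcal{A}\subset\mathcal{B}^{\#}$; $\{x\}^{\uparrow}$ is the principal ultrafilter of $x$; $\beta H$ is the set of ultrafilters on $X$ containing $H$; $A^c=X\setminus A$. A convergence approach space is $(X,\lambda)$ with $\lambda:\mathbb{F}X\to[0,\infty]^{X}$ such that $\mathcal{F}\leq\mathcal{G}$ implies $\lambda(\mathcal{F})\geq\lambda(\mathcal{G})$ pointwise, and $\lambda(\{x\}^{\uparrow})(x)=0$ for all $x$. It is a pre-approach space if $\lambda(\bigcap_{\mathcal{D}\in\mathbb{D}}\mathcal{D})=\bigvee_{\mathcal{D}\in\mathbb{D}}\lambda(\mathcal{D})$ for every (nonempty)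 $\mathbb{D}\subset\mathbb{F}X$. For $\mathcal{G}:X\to\mathbb{F}X$ and $\mathcal{F}\in\mathbb{F}X$, the contour is the filter $\mathcal{G}(\mathcal{F})=\bigcup_{F\in\mathcal{F}}\bigcap_{t\in F}\mathcal{G}(t)$. A non-Archimedean approach space is a pre-approach space such that $\lambda(\mathcal{G}(\mathcal{F}))(x_0)\leq\lambda(\mathcal{F})(x_0)\vee\bigvee_{t\in X}\lambda(\mathcal{G}(t))(t)$ for every $\mathcal{G}:X\to\mathbb{F}X$, $\mathcal{F}\in\mathbb{F}X$, $x_0\in X$. For $\mathcal{F}\subset\mathbb{P}X$, $\operatorname{adh}_\lambda\mathcal{F}(x)=\bigwedge\{\lambda(\mathcal{G})(x):\mathcal{G}\in\mathbb{F}X,\ \mathcal{G}\#\mathcal{F}\}$ (infimum of $\emptyset$ is $\infty$, supremum of $\emptyset$ is $0$). Convergences $c(\lambda),r(\lambda)$ on $X$: $x\in\lim_{c(\lambda)}\mathcal{F}\iff\lambda(\mathcal{F})(x)=0$; $x\in\lim_{r(\lambda)}\mathcal{F}\iff\lambda(\mathcal{F})(x)<\infty$. $A$ is closed for a convergence if $A\in\mathcal{F}$ implies $\lim\mathcal{F}\subset A$; $\mathcal{C}_{c(\lambda)}\supset\mathcal{C}_{r(\lambda)}$ are the corresponding sets of closed sets. For a filter $\mathfrak{F}$ on $\mathcal{C}_X$, $\operatorname{rdc}\mathfrak{F}=\{\bigcup_{C\in\mathcal{A}}C:\mathcal{A}\in\mathfrak{F}\}$. Let $1\oslash y=1/y$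 for $y\in(0,\infty)$, $1\oslash\infty=0$, $1\oslash0=\infty$. For $A\in\mathcal{C}_X$, $$\lambda_{uF}\mathfrak{F}(A)=\bigvee_{H\in(\operatorname{rdc}\mathfrak{F})^{\#},\,H\subset A^{c}}1\oslash m(H),\qquad m(H)=\bigvee_{\mathcal{U}\in\beta H}\bigwedge_{x\in H}\lambda(\mathcal{U})(x),$$ and $\lambda_{uK}\mathfrak{F}(A)=\bigvee_{x\notin A}1\oslash\operatorname{adh}_\lambda(\operatorname{rdc}\mathfrak{F})(x)$. *)

theory Defs
  imports "HOL-Library.Extended_Nonnegative_Real"
begin

text \<open>
  Spaces are carried by arbitrary sets, since the hyperspace of closed sets is one.
  A proper filter on a set \<open>X :: 'a set\<close> is a library filter that is not
  \<open>bot\<close> and is concentrated on \<open>X\<close>; \<open>members_bij\<close> below identifies these with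
  the proper filters of subsets of \<open>X\<close>.  Pitfall: the library order on filters is
  reverse inclusion, so \<open>F \<le> G\<close> says that \<open>F\<close> is finer than \<open>G\<close>,
  and the intersection of a set of filters is its \<open>Sup\<close>.

  A structure \<open>lam\<close> is a function on all filters and points of the type; only its
  values at proper filters on \<open>X\<close> and points of \<open>X\<close> are ever referred to.
\<close>

definition filters_on :: "'a set \<Rightarrow> 'a filter set" where
  "filters_on X = {F. F \<noteq> bot \<and> F \<le> principal X}"

definition members :: "'a set \<Rightarrow> 'a filter \<Rightarrow> 'a set set" where
  "members X F = {A. A \<subseteq> X \<and> eventually (\<lambda>x. x \<in> A) F}"

definition ultrafilters_on :: "'a set \<Rightarrow> 'a filter set" where
  "ultrafilters_on X = {U \<in> filters_on X. \<forall>F\<in>filters_on X. F \<le> U \<longrightarrow> F = U}"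

definition ultrafilters_containing :: "'a set \<Rightarrow> 'a set \<Rightarrow> 'a filter set" where
  "ultrafilters_containing X H = {U \<in> ultrafilters_on X. H \<in> members X U}"

definition grill :: "'a set \<Rightarrow> 'a set set \<Rightarrow> 'a set set" where
  "grill X \<A> = {B. B \<subseteq> X \<and> (\<forall>A\<in>\<A>. A \<inter> B \<noteq> {})}"

definition meshes :: "'a set \<Rightarrow> 'a set set \<Rightarrow> 'a set set \<Rightarrow> bool" where
  "meshes X \<A> \<B> \<longleftrightarrow> \<A> \<subseteq> grill X \<B>"

text \<open>The contour; \<open>members_contour\<close> below gives the set-theoretic formula.\<close>

definition contour :: "'a set \<Rightarrow> ('a \<Rightarrow> 'a filter) \<Rightarrow> 'a filter \<Rightarrow> 'a filter" where
  "contour X \<G> F = (INF S\<in>members X F. SUP t\<in>S. \<G> t)"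

definition convergence_approach ::
    "'a set \<Rightarrow> ('a filter \<Rightarrow> 'a \<Rightarrow> ennreal) \<Rightarrow> bool" where
  "convergence_approach X lam \<longleftrightarrow>
     (\<forall>F\<in>filters_on X. \<forall>G\<in>filters_on X. G \<le> F \<longrightarrow> (\<forall>x\<in>X. lam G x \<le> lam F x)) \<and>
     (\<forall>x\<in>X. lam (principal {x}) x = 0)"

definition pre_approach ::
    "'a set \<Rightarrow> ('a filter \<Rightarrow> 'a \<Rightarrow> ennreal) \<Rightarrow> bool" where
  "pre_approach X lam \<longleftrightarrow>
     convergence_approach X lam \<and>
     (\<forall>\<D>. \<D> \<noteq> {} \<longrightarrow> \<D> \<subseteq> filters_on X \<longrightarrow>
        (\<forall>x\<in>X. lam (Sup \<D>) x = (SUP D\<in>\<D>. lam D x)))"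

definition non_archimedean_approach ::
    "'a set \<Rightarrow> ('a filter \<Rightarrow> 'a \<Rightarrow> ennreal) \<Rightarrow> bool" where
  "non_archimedean_approach X lam \<longleftrightarrow>
     pre_approach X lam \<and>
     (\<forall>\<G>. (\<forall>t\<in>X. \<G> t \<in> filters_on X) \<longrightarrow>
        (\<forall>F\<in>filters_on X. \<forall>x\<^sub>0\<in>X.
           lam (contour X \<G> F) x\<^sub>0 \<le> max (lam F x\<^sub>0) (SUP t\<in>X. lam (\<G> t) t)))"

definition adh ::
    "'a set \<Rightarrow> ('a filter \<Rightarrow> 'a \<Rightarrow> ennreal) \<Rightarrow> 'a set set \<Rightarrow> 'a \<Rightarrow> ennreal" where
  "adh X lam \<F> x = (INF G\<in>{G \<in> filters_on X. meshes X (members X G) \<F>}. lam G x)"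

definition lim_c ::
    "'a set \<Rightarrow> ('a filter \<Rightarrow> 'a \<Rightarrow> ennreal) \<Rightarrow> 'a filter \<Rightarrow> 'a set" where
  "lim_c X lam F = {x \<in> X. lam F x = 0}"

definition lim_r ::
    "'a set \<Rightarrow> ('a filter \<Rightarrow> 'a \<Rightarrow> ennreal) \<Rightarrow> 'a filter \<Rightarrow> 'a set" where
  "lim_r X lam F = {x \<in> X. lam F x < \<infinity>}"

definition closed_sets :: "'a set \<Rightarrow> ('a filter \<Rightarrow> 'a set) \<Rightarrow> 'a set set" where
  "closed_sets X limit = {A. A \<subseteq> X \<and> (\<forall>F\<in>filters_on X. A \<in> members X F \<longrightarrow> limit F \<subseteq> A)}"

definition rdc :: "'a set set \<Rightarrow> 'a set filter \<Rightarrow> 'a set set" where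
  "rdc CX \<FF> = {\<Union>\<A> | \<A>. \<A> \<in> members CX \<FF>}"

text \<open>
  On \<open>ennreal\<close>, \<open>inverse 0 = \<infinity>\<close> and \<open>inverse \<infinity> = 0\<close>.
\<close>

definition measure_uF ::
    "'a set \<Rightarrow> ('a filter \<Rightarrow> 'a \<Rightarrow> ennreal) \<Rightarrow> 'a set \<Rightarrow> ennreal" where
  "measure_uF X lam H = (SUP U\<in>ultrafilters_containing X H. INF x\<in>H. lam U x)"

definition lambda_uF ::
    "'a set \<Rightarrow> ('a filter \<Rightarrow> 'a \<Rightarrow> ennreal) \<Rightarrow> 'a set set \<Rightarrow>
     'a set filter \<Rightarrow> 'a set \<Rightarrow> ennreal" where
  "lambda_uF X lam CX \<FF> A =
     (SUP H\<in>{H \<in> grill X (rdc CX \<FF>). H \<subseteq> X - A}. inverse (measure_uF X lam H))"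

definition lambda_uK ::
    "'a set \<Rightarrow> ('a filter \<Rightarrow> 'a \<Rightarrow> ennreal) \<Rightarrow> 'a set set \<Rightarrow>
     'a set filter \<Rightarrow> 'a set \<Rightarrow> ennreal" where
  "lambda_uK X lam CX \<FF> A = (SUP x\<in>X - A. inverse (adh X lam (rdc CX \<FF>) x))"


lemma eventually_iff_members:
  assumes "F \<in> filters_on X"
  shows "eventually P F \<longleftrightarrow> {x \<in> X. P x} \<in> members X F"
proof -
  have X: "eventually (\<lambda>x. x \<in> X) F"
    using assms by (simp add: filters_on_def le_principal)
  show ?thesis
  proof
    assume "eventually P F"
    with X have "eventually (\<lambda>x. x \<in> X \<and> P x) F"
      by (rule eventually_conj)
    then show "{x \<in> X. P x} \<in> members X F"
      by (simp add: members_def)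
  next
    assume "{x \<in> X. P x} \<in> members X F"
    then have "eventually (\<lambda>x. x \<in> X \<and> P x) F"
      by (simp add: members_def)
    then show "eventually P F"
      by (rule eventually_mono) simp
  qed
qed

lemma members_bij:
  "bij_betw (members X) (filters_on X)
     {\<F>. \<F> \<subseteq> Pow X \<and> X \<in> \<F> \<and> {} \<notin> \<F> \<and> (\<forall>A\<in>\<F>. \<forall>B\<in>\<F>. A \<inter> B \<in> \<F>) \<and>
         (\<forall>A\<in>\<F>. \<forall>B. A \<subseteq> B \<and> B \<subseteq> X \<longrightarrow> B \<in> \<F>)}"
    (is "bij_betw _ _ ?S")
proof (rule bij_betw_imageI)
  show "inj_on (members X) (filters_on X)"
    by (rule inj_onI) (simp add: filter_eq_iff eventually_iff_members)
  show "members X ` filters_on X = ?S"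
  proof (intro equalityI subsetI)
    fix \<F> assume "\<F> \<in> members X ` filters_on X"
    then obtain F where F: "F \<in> filters_on X" and \<F>: "\<F> = members X F"
      by blast
    have "X \<in> \<F>" "{} \<notin> \<F>" "\<F> \<subseteq> Pow X"
      using F by (auto simp: \<F> filters_on_def members_def le_principal trivial_limit_def)
    moreover have "A \<inter> B \<in> \<F>" if "A \<in> \<F>" "B \<in> \<F>" for A B
      using that by (auto simp: \<F> members_def eventually_conj_iff)
    moreover have "B \<in> \<F>" if "A \<in> \<F>" "A \<subseteq> B" "B \<subseteq> X" for A B
      using that by (auto simp: \<F> members_def elim: eventually_mono)
    ultimately show "\<F> \<in> ?S"
      by blast
  next
    fix \<F> assume \<F>: "\<F> \<in> ?S"
    define F where "F = Abs_filter (\<lambda>P. {x \<in> X. P x} \<in> \<F>)"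
    have ev: "eventually P F \<longleftrightarrow> {x \<in> X. P x} \<in> \<F>" for P
      unfolding F_def
    proof (rule eventually_Abs_filter, rule is_filter.intro)
      show "{x \<in> X. True} \<in> \<F>"
        using \<F> by simp
    next
      fix P Q assume "{x \<in> X. P x} \<in> \<F>" "{x \<in> X. Q x} \<in> \<F>"
      then have "{x \<in> X. P x} \<inter> {x \<in> X. Q x} \<in> \<F>"
        using \<F> by blast
      also have "{x \<in> X. P x} \<inter> {x \<in> X. Q x} = {x \<in> X. P x \<and> Q x}"
        by blast
      finally show "{x \<in> X. P x \<and> Q x} \<in> \<F>" .
    next
      fix P Q :: "'a \<Rightarrow> bool"
      assume "\<forall>x. P x \<longrightarrow> Q x" "{x \<in> X. P x} \<in> \<F>"
      moreover from this have "{x \<in> X. P x} \<subseteq> {x \<in> X. Q x}" "{x \<in> X. Q x} \<subseteq> X"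
        by auto
      ultimately show "{x \<in> X. Q x} \<in> \<F>"
        using \<F> by blast
    qed
    have eq: "{x \<in> X. x \<in> A} = A" if "A \<subseteq> X" for A
      using that by blast
    have "F \<in> filters_on X"
      using \<F> by (simp add: filters_on_def le_principal trivial_limit_def ev)
    moreover have "members X F = \<F>"
      using \<F> by (auto simp: members_def ev eq)
    ultimately show "\<F> \<in> members X ` filters_on X"
      by blast
  qed
qed

lemma le_filter_iff_members:
  assumes "F \<in> filters_on X" "G \<in> filters_on X"
  shows "G \<le> F \<longleftrightarrow> members X F \<subseteq> members X G"
proof
  assume "G \<le> F"
  then show "members X F \<subseteq> members X G"
    by (auto simp: members_def le_filter_def)
next
  assume "members X F \<subseteq> members X G"
  then show "G \<le> F"
    using assms by (auto simp: le_filter_def eventually_iff_members)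
qed

lemma members_Sup:
  "\<D> \<noteq> {} \<Longrightarrow> members X (Sup \<D>) = (\<Inter>D\<in>\<D>. members X D)"
  by (auto simp: members_def eventually_Sup)

lemma members_contour:
  assumes "F \<in> filters_on X"
  shows "members X (contour X \<G> F) = (\<Union>S\<in>members X F. {A. A \<subseteq> X \<and> (\<forall>t\<in>S. A \<in> members X (\<G> t))})"
proof -
  have ne: "members X F \<noteq> {}"
    using assms by (auto simp: filters_on_def members_def le_principal)
  have "\<exists>S\<in>members X F. (SUP t\<in>S. \<G> t) \<le> inf (SUP t\<in>A. \<G> t) (SUP t\<in>B. \<G> t)"
    if "A \<in> members X F" "B \<in> members X F" for A B
  proof (rule bexI)
    show "A \<inter> B \<in> members X F"
      using that by (auto simp: members_def eventually_conj_iff)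
    show "(SUP t\<in>A \<inter> B. \<G> t) \<le> inf (SUP t\<in>A. \<G> t) (SUP t\<in>B. \<G> t)"
      by (auto intro!: SUP_subset_mono)
  qed
  from eventually_INF_base[OF ne this] show ?thesis
    by (auto simp: contour_def members_def eventually_Sup)
qed

end

theory Submission
  imports Defs
begin

text \<open>The value \<open>lambda_uF X lam CX \<FF> A\<close> is a supremum of weights
  \<open>inverse (measure_uF X lam H)\<close>, each determined by \<open>H\<close> alone, over the
  sets \<open>H\<close> that miss \<open>A\<close> and lie in the grill of
  \<open>rdc CX \<FF>\<close>. The axioms of a non-Archimedean approach space thus reduce to
  combinatorics of grills: it suffices that each \<open>H\<close> indexing the left-hand side also
  indexes a term on the right (\<open>convergence_approach_lambda_uF\<close>,
  \<open>pre_approach_lambda_uF\<close>, \<open>lambda_uF_contour\<close>). The comparison with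
  \<open>lambda_uK\<close> rests on compactness: each such \<open>H\<close> belongs to an
  ultrafilter \<open>U\<close> meshing with \<open>rdc CX \<FF>\<close>
  (\<open>ultrafilter_meshing_rdc\<close>). The adherence at any point of \<open>H\<close> is then
  at most the value of \<open>lam U\<close> there, and taking the infimum over \<open>H\<close>
  bounds \<open>measure_uF X lam H\<close> from below.\<close>

lemma ultrafilter_below:
  fixes F0 :: "'a filter"
  assumes F0: "F0 \<in> filters_on X"
  obtains U where "U \<in> ultrafilters_on X" "U \<le> F0"
proof -
  let ?A = "{F :: 'a filter. F \<noteq> bot \<and> F \<le> F0}"
  let ?R = "relation_of (\<lambda>F G. G \<le> F) ?A"
  have "\<exists>U\<in>?A. \<forall>F\<in>?A. F \<le> U \<longrightarrow> F = U"
  proof (rule predicate_Zorn)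
    show "partial_order_on ?A ?R"
      by (rule partial_order_on_relation_ofI) auto
  next
    fix C assume C: "C \<in> Chains ?R"
    then have sub: "C \<subseteq> ?A"
      and dir: "\<And>a b. a \<in> C \<Longrightarrow> b \<in> C \<Longrightarrow> a \<le> b \<or> b \<le> a"
      by (auto simp: Chains_def relation_of_def)
    show "\<exists>U\<in>?A. \<forall>F\<in>C. U \<le> F"
    proof (cases "C = {}")
      case True
      then show ?thesis
        using F0 by (auto simp: filters_on_def)
    next
      case False
      \<comment> \<open>A chain is directed downwards, so whatever holds eventually along its
        infimum already holds eventually along one of its members. Hence the infimum is
        proper.\<close>
      have "\<exists>x\<in>C. x \<le> inf a b" if "a \<in> C" "b \<in> C" for a b
        using dir[OF that] that by (metis inf.absorb1 inf.absorb2 order_refl)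
      then have "eventually P (Inf C) \<longleftrightarrow> (\<exists>b\<in>C. eventually P b)" for P
        by (rule eventually_Inf_base[OF False])
      then have "Inf C \<noteq> bot"
        using sub by (auto simp: trivial_limit_def)
      moreover have "Inf C \<le> F0"
        using False sub by (auto intro: Inf_lower2)
      ultimately show ?thesis
        by (auto intro: Inf_lower)
    qed
  qed
  then obtain U where U: "U \<noteq> bot" "U \<le> F0"
    and min: "\<And>F. F \<noteq> bot \<Longrightarrow> F \<le> F0 \<Longrightarrow> F \<le> U \<Longrightarrow> F = U"
    by blast
  have "U \<in> ultrafilters_on X"
    using U F0 min by (auto simp: ultrafilters_on_def filters_on_def intro: order_trans)
  with U show ?thesis
    using that by blast
qed

lemma ereal_inverse_le_swap:
  fixes a b :: ereal
  assumes "0 \<le> a" "0 \<le> b" "inverse a \<le> b"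
  shows "inverse b \<le> a"
  using assms by (cases a; cases b) (auto simp: field_simps split: if_splits)

text \<open>Inversion is an order-reversing involution of the extended half-line, exchanging 0 and
  infinity.\<close>

lemma ennreal_inverse_le_swap:
  fixes a b :: ennreal
  shows "inverse a \<le> b \<Longrightarrow> inverse b \<le> a"
  by (simp add: less_eq_ennreal.rep_eq inverse_ennreal.rep_eq ereal_inverse_le_swap)

lemma grill_rdc_iff:
  "H \<in> grill X (rdc CX \<FF>) \<longleftrightarrow> H \<subseteq> X \<and> (\<forall>\<A>\<in>members CX \<FF>. \<Union>\<A> \<inter> H \<noteq> {})"
  by (auto simp: grill_def rdc_def)

text \<open>Together with \<open>lambda_uF_least\<close> this replaces the definition in all later
  arguments. Inclusion in the complement of \<open>A\<close> becomes disjointness, since sets in the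
  grill lie in \<open>X\<close> anyway.\<close>

lemma lambda_uF_upper:
  "H \<in> grill X (rdc CX \<FF>) \<Longrightarrow> H \<inter> A = {} \<Longrightarrow>
    inverse (measure_uF X lam H) \<le> lambda_uF X lam CX \<FF> A"
  unfolding lambda_uF_def by (rule SUP_upper) (auto simp: grill_def)

lemma lambda_uF_least:
  "(\<And>H. H \<in> grill X (rdc CX \<FF>) \<Longrightarrow> H \<inter> A = {} \<Longrightarrow> inverse (measure_uF X lam H) \<le> c) \<Longrightarrow>
    lambda_uF X lam CX \<FF> A \<le> c"
  unfolding lambda_uF_def by (rule SUP_least) auto

text \<open>A finer filter has more members, hence a smaller grill. For the principal filter of
  \<open>A\<close>, the member \<open>{A}\<close> forces every set in the grill to meet
  \<open>A\<close>, so the supremum is over the empty family.\<close>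

lemma convergence_approach_lambda_uF: "convergence_approach CX (lambda_uF X lam CX)"
  unfolding convergence_approach_def
proof (intro conjI ballI impI)
  fix \<FF> \<GG> A assume "\<FF> \<in> filters_on CX" "\<GG> \<in> filters_on CX" "\<GG> \<le> \<FF>"
  then have "members CX \<FF> \<subseteq> members CX \<GG>"
    by (simp add: le_filter_iff_members)
  then show "lambda_uF X lam CX \<GG> A \<le> lambda_uF X lam CX \<FF> A"
    by (intro lambda_uF_least lambda_uF_upper) (auto simp: grill_rdc_iff)
next
  fix A assume "A \<in> CX"
  then have "{A} \<in> members CX (principal {A})"
    by (simp add: members_def eventually_principal)
  then have "H \<inter> A \<noteq> {}" if "H \<in> grill X (rdc CX (principal {A}))" for H
    using that unfolding grill_rdc_iff by fastforce
  then have "lambda_uF X lam CX (principal {A}) A \<le> 0"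
    by (intro lambda_uF_least) blast
  then show "lambda_uF X lam CX (principal {A}) A = 0"
    by simp
qed

text \<open>
  A set missing the union of some member of every filter of a family misses the union of all these
  members, so the grill of the intersection filter is the union of the grills.
\<close>

lemma pre_approach_lambda_uF: "pre_approach CX (lambda_uF X lam CX)"
  unfolding pre_approach_def
proof (intro conjI allI impI ballI)
  show "convergence_approach CX (lambda_uF X lam CX)"
    by (rule convergence_approach_lambda_uF)
next
  fix \<D> :: "'a set filter set" and A
  assume ne: "\<D> \<noteq> {}" and \<D>: "\<D> \<subseteq> filters_on CX"
  show "lambda_uF X lam CX (Sup \<D>) A = (SUP D\<in>\<D>. lambda_uF X lam CX D A)"
  proof (rule antisym)
    show "lambda_uF X lam CX (Sup \<D>) A \<le> (SUP D\<in>\<D>. lambda_uF X lam CX D A)"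
    proof (rule lambda_uF_least)
      fix H assume H: "H \<in> grill X (rdc CX (Sup \<D>))" "H \<inter> A = {}"
      have "\<exists>D\<in>\<D>. H \<in> grill X (rdc CX D)"
      proof (rule ccontr)
        assume "\<not> ?thesis"
        then have "\<forall>D\<in>\<D>. \<exists>\<A>\<in>members CX D. \<Union>\<A> \<inter> H = {}"
          using H(1) by (auto simp: grill_rdc_iff)
        then obtain \<A> where \<A>: "\<And>D. D \<in> \<D> \<Longrightarrow> \<A> D \<in> members CX D"
          "\<And>D. D \<in> \<D> \<Longrightarrow> \<Union>(\<A> D) \<inter> H = {}"
          by metis
        have "(\<Union>D\<in>\<D>. \<A> D) \<in> members CX (Sup \<D>)"
          using \<A>(1) by (fastforce simp: members_def eventually_Sup elim: eventually_mono)
        with H(1) have "\<Union>(\<Union>D\<in>\<D>. \<A> D) \<inter> H \<noteq> {}"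
          unfolding grill_rdc_iff by blast
        with \<A>(2) show False
          by blast
      qed
      with H(2) show "inverse (measure_uF X lam H) \<le> (SUP D\<in>\<D>. lambda_uF X lam CX D A)"
        by (blast intro: SUP_upper2 lambda_uF_upper)
    qed
    show "(SUP D\<in>\<D>. lambda_uF X lam CX D A) \<le> lambda_uF X lam CX (Sup \<D>) A"
      by (intro SUP_least lambda_uF_least lambda_uF_upper)
        (use ne in \<open>auto simp: grill_rdc_iff members_Sup\<close>)
  qed
qed

text \<open>
  If a set \<open>H\<close> in the grill for the contour missed \<open>\<Union>\<A>\<close> for some \<open>\<A> \<in> members CX \<FF>\<close>, then each
  \<open>B \<in> \<A>\<close> would be disjoint from \<open>H\<close>, so unless \<open>H\<close> contributes to the value at \<open>\<G> B\<close> and \<open>B\<close>,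
  it misses some \<open>\<Union>(\<C> B)\<close> with \<open>\<C> B \<in> members CX (\<G> B)\<close>; but the union of the
  \<open>\<C> B\<close> is a member of the contour.
\<close>

lemma lambda_uF_contour:
  assumes \<FF>: "\<FF> \<in> filters_on CX"
  shows "lambda_uF X lam CX (contour CX \<G> \<FF>) A
    \<le> max (lambda_uF X lam CX \<FF> A) (SUP B\<in>CX. lambda_uF X lam CX (\<G> B) B)"
proof (rule lambda_uF_least)
  fix H assume H: "H \<in> grill X (rdc CX (contour CX \<G> \<FF>))" "H \<inter> A = {}"
  show "inverse (measure_uF X lam H)
    \<le> max (lambda_uF X lam CX \<FF> A) (SUP B\<in>CX. lambda_uF X lam CX (\<G> B) B)"
  proof (cases "H \<in> grill X (rdc CX \<FF>)")
    case True
    with H(2) show ?thesis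
      by (simp add: lambda_uF_upper max.coboundedI1)
  next
    case False
    then obtain \<A> where \<A>: "\<A> \<in> members CX \<FF>" "\<Union>\<A> \<inter> H = {}"
      using H(1) by (auto simp: grill_rdc_iff)
    have "\<exists>B\<in>\<A>. H \<in> grill X (rdc CX (\<G> B))"
    proof (rule ccontr)
      assume "\<not> ?thesis"
      then have "\<forall>B\<in>\<A>. \<exists>\<C>\<in>members CX (\<G> B). \<Union>\<C> \<inter> H = {}"
        using H(1) by (auto simp: grill_rdc_iff)
      then obtain \<C> where \<C>: "\<And>B. B \<in> \<A> \<Longrightarrow> \<C> B \<in> members CX (\<G> B)"
        "\<And>B. B \<in> \<A> \<Longrightarrow> \<Union>(\<C> B) \<inter> H = {}"
        by metis
      have "(\<Union>B\<in>\<A>. \<C> B) \<in> members CX (\<G> B)" if "B \<in> \<A>" for B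
        using \<C>(1) that by (fastforce simp: members_def elim: eventually_mono)
      moreover have "(\<Union>B\<in>\<A>. \<C> B) \<subseteq> CX"
        using \<C>(1) by (auto simp: members_def)
      \<comment> \<open>In the set formula for the contour, \<open>\<A>\<close> is the member of
        \<open>\<FF>\<close> along which the filters \<open>\<G> B\<close> are intersected.\<close>
      ultimately have "(\<Union>B\<in>\<A>. \<C> B) \<in> members CX (contour CX \<G> \<FF>)"
        using \<A>(1) by (auto simp: members_contour[OF \<FF>])
      with H(1) have "\<Union>(\<Union>B\<in>\<A>. \<C> B) \<inter> H \<noteq> {}"
        unfolding grill_rdc_iff by blast
      with \<C>(2) show False
        by blast
    qed
    then obtain B where B: "B \<in> \<A>" "H \<in> grill X (rdc CX (\<G> B))"
      by blast
    then have "B \<in> CX" "H \<inter> B = {}"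
      using \<A> by (auto simp: members_def)
    with B(2) show ?thesis
      by (intro max.coboundedI2) (blast intro: SUP_upper2 lambda_uF_upper)
  qed
qed

lemma non_archimedean_approach_lambda_uF:
  "non_archimedean_approach CX (lambda_uF X lam CX)"
  unfolding non_archimedean_approach_def
  by (intro conjI allI impI ballI pre_approach_lambda_uF lambda_uF_contour)

text \<open>The traces \<open>\<Union>\<A> \<inter> H\<close> are nonempty because \<open>H\<close>
  is in the grill, and they form a filter base. Any ultrafilter finer than the filter they generate
  contains \<open>H\<close> and every \<open>\<Union>\<A>\<close>, so all its members meet every
  \<open>\<Union>\<A>\<close>.\<close>

lemma ultrafilter_meshing_rdc:
  assumes \<FF>: "\<FF> \<in> filters_on CX" and H: "H \<in> grill X (rdc CX \<FF>)"
  obtains U where "U \<in> ultrafilters_containing X H" "meshes X (members X U) (rdc CX \<FF>)"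
proof -
  define F0 where "F0 = (INF \<A>\<in>members CX \<FF>. principal (\<Union>\<A> \<inter> H))"
  have ne: "members CX \<FF> \<noteq> {}"
    using \<FF> by (auto simp: filters_on_def members_def le_principal)
  \<comment> \<open>The union of \<open>\<A> \<inter> \<B>\<close> may be smaller than the
    intersection of the two unions, but a filter base needs only this inclusion.\<close>
  have "\<exists>\<C>\<in>members CX \<FF>. principal (\<Union>\<C> \<inter> H) \<le> inf (principal (\<Union>\<A> \<inter> H)) (principal (\<Union>\<B> \<inter> H))"
    if "\<A> \<in> members CX \<FF>" "\<B> \<in> members CX \<FF>" for \<A> \<B>
    using that by (intro bexI[of _ "\<A> \<inter> \<B>"]) (auto simp: members_def eventually_conj_iff)
  from eventually_INF_base[OF ne this]
  have ev: "eventually P F0 \<longleftrightarrow> (\<exists>\<A>\<in>members CX \<FF>. \<forall>x\<in>\<Union>\<A> \<inter> H. P x)" for P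
    by (simp add: F0_def eventually_principal)
  have evH: "eventually (\<lambda>x. x \<in> H) F0"
    using ne by (auto simp: ev)
  have "F0 \<noteq> bot"
    using H by (fastforce simp: grill_rdc_iff trivial_limit_def ev)
  moreover have "eventually (\<lambda>x. x \<in> X) F0"
    using evH by (rule eventually_mono) (use H in \<open>auto simp: grill_def\<close>)
  ultimately have "F0 \<in> filters_on X"
    by (simp add: filters_on_def le_principal)
  then obtain U where U: "U \<in> ultrafilters_on X" "U \<le> F0"
    by (rule ultrafilter_below)
  then have "U \<noteq> bot"
    by (simp add: ultrafilters_on_def filters_on_def)
  have "eventually (\<lambda>x. x \<in> H) U"
    using U(2) evH by (rule filter_leD)
  then have "U \<in> ultrafilters_containing X H"
    using U(1) H by (simp add: ultrafilters_containing_def members_def grill_def)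
  moreover have "\<Union>\<A> \<inter> S \<noteq> {}" if "S \<in> members X U" "\<A> \<in> members CX \<FF>" for S \<A>
  proof -
    have "eventually (\<lambda>x. x \<in> \<Union>\<A>) F0"
      using that(2) unfolding ev by blast
    then have "eventually (\<lambda>x. x \<in> \<Union>\<A>) U"
      by (rule filter_leD[OF U(2)])
    moreover have "eventually (\<lambda>x. x \<in> S) U"
      using that(1) by (simp add: members_def)
    ultimately have "eventually (\<lambda>x. x \<in> \<Union>\<A> \<and> x \<in> S) U"
      by (rule eventually_conj)
    then show ?thesis
      using eventually_happens'[OF \<open>U \<noteq> bot\<close>] by blast
  qed
  then have "S \<in> grill X (rdc CX \<FF>)" if "S \<in> members X U" for S
    using that unfolding grill_rdc_iff by (simp add: members_def)
  then have "meshes X (members X U) (rdc CX \<FF>)"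
    unfolding meshes_def by blast
  ultimately show ?thesis
    using that by blast
qed

lemma lambda_uF_le_lambda_uK:
  assumes "\<FF> \<in> filters_on CX"
  shows "lambda_uF X lam CX \<FF> A \<le> lambda_uK X lam CX \<FF> A"
proof (rule lambda_uF_least)
  fix H assume H: "H \<in> grill X (rdc CX \<FF>)" "H \<inter> A = {}"
  let ?K = "lambda_uK X lam CX \<FF> A"
  obtain U where U: "U \<in> ultrafilters_containing X H" "meshes X (members X U) (rdc CX \<FF>)"
    using ultrafilter_meshing_rdc[OF assms H(1)] .
  \<comment> \<open>Inverting the goal turns it into a lower bound for
    \<open>measure_uF X lam H\<close>, a supremum over ultrafilters, so the single \<open>U\<close>
    suffices.\<close>
  have "inverse ?K \<le> lam U x" if "x \<in> H" for x
  proof -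
    have "x \<in> X - A"
      using that H by (auto simp: grill_def)
    then have "inverse (adh X lam (rdc CX \<FF>) x) \<le> ?K"
      unfolding lambda_uK_def by (rule SUP_upper)
    then have "inverse ?K \<le> adh X lam (rdc CX \<FF>) x"
      by (rule ennreal_inverse_le_swap)
    \<comment> \<open>\<open>U\<close> meshes with \<open>rdc CX \<FF>\<close>, so it is among the
      filters over which the adherence takes its infimum.\<close>
    also have "\<dots> \<le> lam U x"
      unfolding adh_def
      by (rule INF_lower) (use U in \<open>auto simp: ultrafilters_containing_def ultrafilters_on_def\<close>)
    finally show ?thesis .
  qed
  then have "inverse ?K \<le> measure_uF X lam H"
    unfolding measure_uF_def using U(1) by (blast intro: SUP_upper2 INF_greatest)
  then show "inverse (measure_uF X lam H) \<le> ?K"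
    by (rule ennreal_inverse_le_swap)
qed

theorem theorem32:
  fixes X :: "'a set" and lam :: "'a filter \<Rightarrow> 'a \<Rightarrow> ennreal" and CX :: "'a set set"
  assumes "convergence_approach X lam"
    and "CX = closed_sets X (lim_c X lam) \<or> CX = closed_sets X (lim_r X lam)"
  shows "non_archimedean_approach CX (lambda_uF X lam CX) \<and>
    (\<forall>\<FF>\<in>filters_on CX. \<forall>A\<in>CX. lambda_uF X lam CX \<FF> A \<le> lambda_uK X lam CX \<FF> A)"
  by (simp add: non_archimedean_approach_lambda_uF lambda_uF_le_lambda_uK)

end
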